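(* For any integers $k \ge \ell \ge 3$, there exists a graph $G$ such that $G \nrightarrow (K_k,K_{\ell})$ and $G \rightarrow (K_{s},K_{\ell-1})$ for $s\leq R(k,\ell)-1$.
   Context: For a graph $G$ and positive integers $a,b$, $G \rightarrow (K_a,K_b)$ means every red-blue colouring of the edges of $G$ contains a red copy of $K_a$ or a blue copy of $K_b$; $G\nrightarrow (K_a,K_b)$ is its negation. $R(k,\ell)$ is the minimum $n$ such that $K_n\rightarrow (K_k,K_\ell)$. *)

theory Defs
  imports "HOL-Library.Ramsey"
begin

definition fin_graph :: "'a set \<Rightarrow> 'a set set \<Rightarrow> bool" where
  "fin_graph V E \<longleftrightarrow> finite V \<and> E \<subseteq> [V]\<^bsup>2\<^esup>"

datatype colour = Red | Blue

text \<open>The values of a colouring outside \<open>E\<close> are irrelevant, since only edges are inspected.\<close>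

definition colour_class :: "'a set set \<Rightarrow> ('a set \<Rightarrow> colour) \<Rightarrow> colour \<Rightarrow> 'a set set" where
  "colour_class E c i = {e \<in> E. c e = i}"

definition arrows :: "'a set \<Rightarrow> 'a set set \<Rightarrow> nat \<Rightarrow> nat \<Rightarrow> bool" where
  "arrows V E a b \<longleftrightarrow>
     (\<forall>c. (\<exists>S \<in> [V]\<^bsup>a\<^esup>. clique S (colour_class E c Red)) \<or>
          (\<exists>S \<in> [V]\<^bsup>b\<^esup>. clique S (colour_class E c Blue)))"

definition ramsey_number :: "nat \<Rightarrow> nat \<Rightarrow> nat" where
  "ramsey_number k l = (LEAST n. arrows {..<n} ([{..<n}]\<^bsup>2\<^esup>) k l)"

text \<open>By Ramsey's theorem the minimum is attained.\<close>

lemma arrows_ramsey_number: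
  "arrows {..<ramsey_number k l} ([{..<ramsey_number k l}]\<^bsup>2\<^esup>) k l"
proof -
  obtain r where r: "\<And>(V::nat set) E. finite V \<Longrightarrow> card V \<ge> r \<Longrightarrow>
      \<exists>R \<subseteq> V. card R = k \<and> clique R E \<or> card R = l \<and> indep R E"
    using ramsey2[of k l] by metis
  have "arrows {..<r} ([{..<r}]\<^bsup>2\<^esup>) k l"
    unfolding arrows_def
  proof
    fix c
    let ?E = "[{..<r}]\<^bsup>2\<^esup>"
    obtain R where R: "R \<subseteq> {..<r}"
        "card R = k \<and> clique R (colour_class ?E c Red) \<or> card R = l \<and> indep R (colour_class ?E c Red)"
      using r[of "{..<r}" "colour_class ?E c Red"] unfolding card_lessThan by blast
    have fin: "finite R"
      using R(1) finite_subset by blast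
    have "clique R (colour_class ?E c Blue)" if ind: "indep R (colour_class ?E c Red)"
      unfolding clique_def
    proof (intro ballI impI)
      fix v w assume vw: "v \<in> R" "w \<in> R" "v \<noteq> w"
      then have E: "{v, w} \<in> ?E"
        using R(1) unfolding doubleton_in_nsets_2 by blast
      have "{v, w} \<notin> colour_class ?E c Red"
        using ind vw unfolding indep_def by blast
      with E have "c {v, w} \<noteq> Red"
        unfolding colour_class_def by blast
      then have "c {v, w} = Blue"
        by (cases "c {v, w}") simp_all
      with E show "{v, w} \<in> colour_class ?E c Blue"
        unfolding colour_class_def by blast
    qed
    then show "(\<exists>S \<in> [{..<r}]\<^bsup>k\<^esup>. clique S (colour_class ?E c Red)) \<or>
          (\<exists>S \<in> [{..<r}]\<^bsup>l\<^esup>. clique S (colour_class ?E c Blue))"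
      using R fin unfolding nsets_def by blast
  qed
  then show ?thesis
    unfolding ramsey_number_def by (rule LeastI)
qed

end

theory Submission
  imports Defs
begin

text \<open>
  Fix a red/blue labelling of \<open>K\<^sub>n\<close>, \<open>n = R(k,l) - 1\<close>, without red \<open>K\<^sub>k\<close> and blue \<open>K\<^sub>l\<close>, and add a
  disjoint red \<open>K\<^bsub>l-1\<^esub>\<close> and a disjoint blue \<open>K\<^bsub>l-1\<^esub>\<close>; as \<open>k \<ge> l\<close>, the result still has no red \<open>K\<^sub>k\<close> and no
  blue \<open>K\<^sub>l\<close>. The partite construction of Nesetril and Rodl gives a larger labelled graph, again
  without red \<open>K\<^sub>k\<close> and blue \<open>K\<^sub>l\<close>, such that every colouring of its edges admits a copy of the
  original one on which the colour of an edge depends only on its label. The labelling witnesses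
  that the larger graph does not arrow \<open>(K\<^sub>k, K\<^sub>l)\<close>. Given a colouring, either both labels are
  coloured red in the copy, so the \<open>K\<^sub>n\<close> is red, or one label is coloured blue, and the
  \<open>K\<^bsub>l-1\<^esub>\<close> of this label is blue.
\<close>

section \<open>A bipartite Ramsey lemma\<close>

lemma sorted_list_of_set_image_lessThan:
  fixes s :: "nat \<Rightarrow> 'a :: linorder"
  assumes "strict_mono_on {..<q} s"
  shows "sorted_list_of_set (s ` {..<q}) = map s [0..<q]"
proof (rule sorted_distinct_set_unique)
  have "sorted_wrt (<) (map s [0..<q])"
    using assms by (auto simp: sorted_wrt_iff_nth_less strict_mono_on_def)
  then show "sorted (map s [0..<q])" "distinct (map s [0..<q])"
    by (simp_all add: strict_sorted_iff)
qed (auto simp: atLeast0LessThan)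

text \<open>The increasing enumeration \<open>h\<close> of a homogeneous set preserves positions
  within \<open>q\<close>-sets, on which the bipartite construction depends. The palette is an
  arbitrary finite set because the colours will be sets of positions.\<close>

lemma ramsey_increasing:
  fixes C :: "'c set" and m q :: nat
  assumes "finite C"
  shows "\<exists>M::nat. \<forall>col. col ` [{..<M}]\<^bsup>q\<^esup> \<subseteq> C \<longrightarrow>
       (\<exists>h z. strict_mono_on {..<m} h \<and> h ` {..<m} \<subseteq> {..<M} \<and> (\<forall>T\<in>[{..<m}]\<^bsup>q\<^esup>. col (h ` T) = z))"
proof -
  define n where "n = card C"
  \<comment> \<open>The palette is renumbered, since \<open>partn_lst\<close> takes its colours from
    an initial segment.\<close>
  obtain e where e: "bij_betw e C {..<n}"
    using assms finite_same_card_bij n_def by (metis card_lessThan finite_lessThan)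
  obtain M :: nat where M: "partn_lst {..<M} (replicate n m) q"
    using ramsey_full by blast
  show ?thesis
  proof (intro exI[of _ M] allI impI)
    fix col :: "nat set \<Rightarrow> 'c" assume col: "col ` [{..<M}]\<^bsup>q\<^esup> \<subseteq> C"
    have "(\<lambda>S. e (col S)) \<in> [{..<M}]\<^bsup>q\<^esup> \<rightarrow> {..<n}"
      using col e by (auto simp: bij_betw_def)
    from partn_lstE[OF M this] obtain i H where
      i: "i < n" and H: "H \<in> [{..<M}]\<^bsup>m\<^esup>" and eq: "(\<lambda>S. e (col S)) ` [H]\<^bsup>q\<^esup> \<subseteq> {i}"
      by auto
    from H have Hs: "H \<subseteq> {..<M}" "finite H" "card H = m"
      by (auto simp: nsets_def)
    define h where "h = (\<lambda>j. sorted_list_of_set H ! j)"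
    have mono: "strict_mono_on {..<m} h"
      using Hs strict_sorted_list_of_set[of H]
      by (auto simp: strict_mono_on_def h_def sorted_wrt_iff_nth_less)
    have im: "h ` {..<m} = H"
      unfolding h_def using Hs
      by (metis atLeast0LessThan distinct_card image_cong nth_image order_refl set_sorted_list_of_set
          sorted_list_of_set.distinct_sorted_key_list_of_set take_all_iff)
    have "col (h ` T) = inv_into C e i" if T: "T \<in> [{..<m}]\<^bsup>q\<^esup>" for T
    proof -
      have "inj_on h {..<m}"
        using mono strict_mono_on_imp_inj_on by blast
      then have hT: "h ` T \<in> [H]\<^bsup>q\<^esup>"
        using T im nsets_image_funcset[of h "{..<m}" H q] by auto
      then have "e (col (h ` T)) = i"
        using eq by blast
      moreover have "col (h ` T) \<in> C"
        using col hT nsets_mono[OF Hs(1)] by blast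
      ultimately show ?thesis
        using e by (metis bij_betw_def inv_into_f_f)
    qed
    then show "\<exists>h z. strict_mono_on {..<m} h \<and> h ` {..<m} \<subseteq> {..<M} \<and>
        (\<forall>T\<in>[{..<m}]\<^bsup>q\<^esup>. col (h ` T) = z)"
      using mono im Hs(1) by blast
  qed
qed

text \<open>Pigeonhole. \<open>P i\<close> will say that the even position \<open>2 * i\<close> is
  red; the \<open>p\<close> indices of one colour leave a block for each vertex of
  \<open>X\<close>.\<close>

lemma majority:
  fixes P :: "nat \<Rightarrow> bool"
  obtains I t where "I \<subseteq> {..<2 * p + 1}" "card I \<ge> p" "\<And>i. i \<in> I \<Longrightarrow> P i = t"
proof -
  let ?A = "{i \<in> {..<2 * p + 1}. P i}" and ?B = "{i \<in> {..<2 * p + 1}. \<not> P i}"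
  have "card ?A + card ?B = card (?A \<union> ?B)"
    by (rule card_Un_disjoint [symmetric]) auto
  also have "?A \<union> ?B = {..<2 * p + 1}" by auto
  finally have "card ?A \<ge> p \<or> card ?B \<ge> p" unfolding card_lessThan by linarith
  then show thesis
  proof
    assume "card ?A \<ge> p"
    then show thesis by (intro that[of ?A True]) auto
  next
    assume "card ?B \<ge> p"
    then show thesis by (intro that[of ?B False]) auto
  qed
qed

fun opposite :: "colour \<Rightarrow> colour" where
  "opposite Red = Blue"
| "opposite Blue = Red"

lemma colour_neq_iff: "a \<noteq> b \<longleftrightarrow> a = opposite b"
  by (cases a; cases b) auto

text \<open>The vertices of \<open>Y'\<close> are the \<open>q\<close>-subsets of \<open>X'\<close>, and the label of the pair of \<open>v\<close> and \<open>S\<close> is given by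
  the parity of the position of \<open>v\<close> in the increasing enumeration of \<open>S\<close>. By Ramsey's theorem for
  \<open>q\<close>-sets the colour of this pair may be assumed to depend only on the position, and half of the even
  positions get the same colour.\<close>

lemma bipartite_ramsey:
  fixes X :: "'a set" and Y :: "'b set" and L :: "'a \<Rightarrow> 'b \<Rightarrow> colour option" and b :: colour
  assumes "finite X" "finite Y"
  shows "\<exists>(X' :: nat set) (Y' :: nat set set) L'. finite X' \<and> finite Y' \<and>
    (\<forall>c. \<exists>f g. inj_on f X \<and> f ` X \<subseteq> X' \<and> inj_on g Y \<and> g ` Y \<subseteq> Y' \<and>
       (\<forall>x\<in>X. \<forall>y\<in>Y. L' (f x) (g y) = L x y) \<and>
       (\<exists>a. \<forall>x\<in>X. \<forall>y\<in>Y. L x y = Some b \<longrightarrow> c (f x) (g y) = (a :: colour)))"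
proof -
  define p r where "p = card X" and "r = card Y"
  \<comment> \<open>The ground set \<open>{..<m}\<close> is cut into \<open>2 * p + 1\<close> blocks
    of length \<open>W\<close>. A block has its centre at offset \<open>r\<close>, with at least
    \<open>r\<close> offsets on either side. Each \<open>q\<close>-set used below takes an even and
    an odd position from every block.\<close>
  define W where "W = 2 * r + 2"
  define q where "q = 2 * (2 * p + 1)"
  define m where "m = (2 * p + 1) * W"
  obtain d where d: "inj_on d Y" "d ` Y \<subseteq> {..<r}"
    using assms(2) r_def by (metis card_lessThan card_le_inj finite_lessThan order_refl)
  obtain M where M: "\<And>col :: nat set \<Rightarrow> nat set. col ` [{..<M}]\<^bsup>q\<^esup> \<subseteq> Pow {..<q} \<Longrightarrow>
       \<exists>h z. strict_mono_on {..<m} h \<and> h ` {..<m} \<subseteq> {..<M} \<and> (\<forall>T\<in>[{..<m}]\<^bsup>q\<^esup>. col (h ` T) = z)"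
    using ramsey_increasing[of "Pow {..<q}" q m] unfolding finite_Pow_iff
    using finite_lessThan by blast
  define nth_el where "nth_el = (\<lambda>(S :: nat set) j. sorted_list_of_set S ! j)"
  define L' where "L' = (\<lambda>v S. if \<exists>j<q. even j \<and> nth_el S j = v then Some b
     else if \<exists>j<q. odd j \<and> nth_el S j = v then Some (opposite b) else None)"
  have "\<exists>f g. inj_on f X \<and> f ` X \<subseteq> {..<M} \<and> inj_on g Y \<and> g ` Y \<subseteq> [{..<M}]\<^bsup>q\<^esup> \<and>
       (\<forall>x\<in>X. \<forall>y\<in>Y. L' (f x) (g y) = L x y) \<and>
       (\<exists>a. \<forall>x\<in>X. \<forall>y\<in>Y. L x y = Some b \<longrightarrow> c (f x) (g y) = a)" for c :: "nat \<Rightarrow> nat set \<Rightarrow> colour"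
  proof -
    \<comment> \<open>An edge colouring becomes a colouring of the \<open>q\<close>-sets:
      \<open>S\<close> is coloured by the set of positions whose pair with \<open>S\<close> is
      red.\<close>
    define col where "col = (\<lambda>S. {j \<in> {..<q}. c (nth_el S j) S = Red})"
    have "col ` [{..<M}]\<^bsup>q\<^esup> \<subseteq> Pow {..<q}"
      by (auto simp: col_def)
    from M[OF this] obtain h z where "strict_mono_on {..<m} h \<and> h ` {..<m} \<subseteq> {..<M} \<and>
        (\<forall>T\<in>[{..<m}]\<^bsup>q\<^esup>. col (h ` T) = z)"
      by (elim exE)
    then have h: "strict_mono_on {..<m} h" "h ` {..<m} \<subseteq> {..<M}"
      and z: "\<And>T. T \<in> [{..<m}]\<^bsup>q\<^esup> \<Longrightarrow> col (h ` T) = z"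
      by simp_all
    have h_inj: "inj_on h {..<m}"
      using h(1) strict_mono_on_imp_inj_on by blast
    obtain I t where I: "I \<subseteq> {..<2 * p + 1}" "card I \<ge> p" "\<And>i. i \<in> I \<Longrightarrow> (2 * i \<in> z) = t"
      using majority[of p "\<lambda>i. 2 * i \<in> z"] by blast
    \<comment> \<open>Each \<open>x\<close> receives a block of its own among those whose even
      position has the common colour.\<close>
    obtain \<kappa> where \<kappa>: "\<kappa> ` X \<subseteq> I" "inj_on \<kappa> X"
      using card_le_inj[of X I] I(1,2) assms(1) p_def finite_subset[OF I(1)] by auto
    have \<kappa>_less: "\<kappa> x < 2 * p + 1" if "x \<in> X" for x
      using \<kappa>(1) I(1) that by auto
    \<comment> \<open>Blocks that host no vertex of \<open>X\<close> carry no label, so that their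
      elements avoid the centre.\<close>
    define lab where "lab = (\<lambda>i y. if i \<in> \<kappa> ` X then L (inv_into X \<kappa> i) y else None)"
    have lab: "lab (\<kappa> x) y = L x y" if "x \<in> X" for x y
      using that \<kappa>(2) by (simp add: lab_def)
    \<comment> \<open>In block \<open>i\<close> the set of \<open>y\<close> meets the centre in its
      lower element for label \<open>b\<close>, in its upper element for the other label, and not at
      all for \<open>None\<close>. Off the centre the offset encodes \<open>d y\<close>, which keeps
      the sets of different \<open>y\<close> apart.\<close>
    define lo where "lo = (\<lambda>i y. if lab i y = Some b then r else d y)"
    define hi where "hi = (\<lambda>i y. if lab i y = Some (opposite b) then r else r + 1 + d y)"
    define u where "u = (\<lambda>y j. j div 2 * W + (if even j then lo (j div 2) y else hi (j div 2) y))"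
    have d_less: "d y < r" if "y \<in> Y" for y
      using d(2) that by auto
    have lo_hi: "lo i y < hi i y" "hi i y < W" "lo i y < W" if "y \<in> Y" for i y
      using d_less[OF that] by (auto simp: lo_def hi_def W_def colour_neq_iff split: colour.splits)
        (cases b; simp)+
    have u_mono: "u y j < u y j'" if y: "y \<in> Y" and "j < j'" for y j j'
    proof (cases "j div 2 = j' div 2")
      case True
      then have "even j" "odd j'" using \<open>j < j'\<close> by presburger+
      then show ?thesis using True lo_hi[OF y] by (simp add: u_def)
    next
      case False
      then have "Suc (j div 2) \<le> j' div 2" using \<open>j < j'\<close> by presburger
      then have "Suc (j div 2) * W \<le> j' div 2 * W" by (rule mult_le_mono1)
      moreover have "u y j < Suc (j div 2) * W" using lo_hi[OF y] by (simp add: u_def)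
      ultimately show ?thesis by (simp add: u_def)
    qed
    have u_less: "u y j < m" if y: "y \<in> Y" and "j < q" for y j
    proof -
      have "Suc (j div 2) \<le> 2 * p + 1" using \<open>j < q\<close> by (simp add: q_def)
      then have "Suc (j div 2) * W \<le> m" unfolding m_def by (rule mult_le_mono1)
      moreover have "u y j < Suc (j div 2) * W" using lo_hi[OF y] by (simp add: u_def)
      ultimately show ?thesis by simp
    qed
    have block_div: "(i * W + a) div W = i" if "a < W" for i a
      using that by simp
    have W_less: "r < W"
      by (simp add: W_def)
    \<comment> \<open>Division by \<open>W\<close> recovers the block, so the centre of block
      \<open>i\<close> can only be hit from the positions \<open>2 * i\<close> and
      \<open>2 * i + 1\<close>, and the label decides which.\<close>
    have u_eq: "u y j = i * W + r \<longleftrightarrow> j div 2 = i \<and> lab i y = Some (if even j then b else opposite b)"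
      if y: "y \<in> Y" for y i j
    proof -
      have "u y j = i * W + r \<longleftrightarrow> j div 2 = i \<and> (if even j then lo i y else hi i y) = r"
      proof
        assume eq: "u y j = i * W + r"
        have "u y j div W = j div 2" "(i * W + r) div W = i"
          using lo_hi[OF y] by (simp_all add: u_def W_less block_div)
        with eq have "j div 2 = i" by simp
        with eq show "j div 2 = i \<and> (if even j then lo i y else hi i y) = r"
          by (simp add: u_def split: if_splits)
      qed (auto simp: u_def)
      then show ?thesis
        using d_less[OF y] by (auto simp: lo_def hi_def)
    qed
    define f where "f = (\<lambda>x. h (\<kappa> x * W + r))"
    define g where "g = (\<lambda>y. h ` u y ` {..<q})"
    have base_less: "\<kappa> x * W + r < m" if "x \<in> X" for x
    proof -
      have "Suc (\<kappa> x) * W \<le> m" unfolding m_def using \<kappa>_less[OF that] by (intro mult_le_mono1) simp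
      then show ?thesis by (simp add: W_def)
    qed
    have u_im: "u y ` {..<q} \<in> [{..<m}]\<^bsup>q\<^esup>" if y: "y \<in> Y" for y
    proof -
      have "inj_on (u y) {..<q}"
        by (rule inj_onI) (metis u_mono[OF y] linorder_neqE_nat less_irrefl)
      then show ?thesis using u_less[OF y] by (auto simp: nsets_def card_image)
    qed
    have nth_g: "nth_el (g y) j = h (u y j)" if y: "y \<in> Y" and "j < q" for y j
    proof -
      have "strict_mono_on {..<q} (\<lambda>j. h (u y j))"
        using h(1) u_mono[OF y] u_less[OF y] by (auto simp: strict_mono_on_def)
      from sorted_list_of_set_image_lessThan[OF this] show ?thesis
        using \<open>j < q\<close> by (simp add: nth_el_def g_def image_image)
    qed
    have nth_g_f: "nth_el (g y) j = f x \<longleftrightarrow>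
        j div 2 = \<kappa> x \<and> L x y = Some (if even j then b else opposite b)"
      if "x \<in> X" "y \<in> Y" "j < q" for x y j
    proof -
      have "nth_el (g y) j = f x \<longleftrightarrow> u y j = \<kappa> x * W + r"
        using that h_inj u_less base_less by (auto simp: nth_g f_def inj_on_eq_iff)
      then show ?thesis using u_eq[OF that(2)] lab[OF that(1)] by simp
    qed
    have Lfg: "L' (f x) (g y) = L x y" if x: "x \<in> X" and y: "y \<in> Y" for x y
    proof -
      have "(\<exists>j<q. even j \<and> nth_el (g y) j = f x) \<longleftrightarrow> L x y = Some b"
        using nth_g_f[OF x y] \<kappa>_less[OF x]
        by (auto simp: q_def intro!: exI[of _ "2 * \<kappa> x"])
      moreover have "(\<exists>j<q. odd j \<and> nth_el (g y) j = f x) \<longleftrightarrow> L x y = Some (opposite b)"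
        using nth_g_f[OF x y] \<kappa>_less[OF x]
        by (auto simp: q_def intro!: exI[of _ "2 * \<kappa> x + 1"])
      ultimately show ?thesis
        by (cases "L x y") (auto simp: L'_def, metis colour_neq_iff)
    qed
    \<comment> \<open>Label \<open>b\<close> puts \<open>f x\<close> at the even position
      \<open>2 * \<kappa> x\<close> of \<open>g y\<close>. By homogeneity the colour depends on the
      position only, and \<open>\<kappa> x \<in> I\<close> makes it the common one.\<close>
    have "c (f x) (g y) = (if t then Red else Blue)" if x: "x \<in> X" and y: "y \<in> Y" and "L x y = Some b" for x y
    proof -
      have q: "2 * \<kappa> x < q" using \<kappa>_less[OF x] by (simp add: q_def)
      then have "nth_el (g y) (2 * \<kappa> x) = f x"
        using nth_g_f[OF x y] that(3) by simp
      moreover have "col (g y) = z"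
        using z[OF u_im[OF y]] by (simp add: g_def)
      ultimately have "c (f x) (g y) = Red \<longleftrightarrow> 2 * \<kappa> x \<in> z"
        using q by (auto simp: col_def)
      then show ?thesis
        using I(3) \<kappa>(1) x by (cases "c (f x) (g y)") auto
    qed
    moreover have "inj_on f X"
    proof (rule inj_onI)
      fix x x' assume xx: "x \<in> X" "x' \<in> X" "f x = f x'"
      then have "\<kappa> x * W + r = \<kappa> x' * W + r"
        using h_inj base_less by (auto simp: f_def inj_on_eq_iff)
      then have "\<kappa> x = \<kappa> x'" using W_less by simp
      then show "x = x'" using \<kappa>(2) xx by (simp add: inj_on_eq_iff)
    qed
    moreover have "inj_on g Y"
    proof (rule inj_onI)
      fix y y' assume yy: "y \<in> Y" "y' \<in> Y" "g y = g y'"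
      have "u y j = u y' j" if "j < q" for j
        using nth_g[OF yy(1) that] nth_g[OF yy(2) that] yy h_inj u_less that
        by (auto simp: inj_on_eq_iff)
      \<comment> \<open>At most one of the two elements of block 0 lies at the centre; the other one
        reveals \<open>d y\<close>.\<close>
      from this[of 0] this[of 1] have "lo 0 y = lo 0 y'" "hi 0 y = hi 0 y'"
        by (simp_all add: u_def q_def)
      then have "d y = d y'"
        using d_less[OF yy(1)] d_less[OF yy(2)]
        by (cases b) (auto simp: lo_def hi_def split: if_splits)
      then show "y = y'" using d(1) yy by (simp add: inj_on_eq_iff)
    qed
    moreover have "f ` X \<subseteq> {..<M}"
      using base_less h(2) by (auto simp: f_def)
    moreover have "g ` Y \<subseteq> [{..<M}]\<^bsup>q\<^esup>"
      using u_im nsets_image_funcset[of h "{..<m}" "{..<M}" q] h(2) h_inj by (auto simp: g_def)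
    ultimately show ?thesis using Lfg by blast
  qed
  then show ?thesis
    by (intro exI[of _ "{..<M}"] exI[of _ "[{..<M}]\<^bsup>q\<^esup>"] exI[of _ L'])
       (auto intro: finite_imp_finite_nsets)
qed

section \<open>Partite graphs with labelled edges\<close>

text \<open>\<open>L\<close> labels the edges with colours, \<open>\<pi>\<close> maps each vertex to the index of its part, and no set of
  \<open>K a\<close> vertices is a clique of label \<open>a\<close>. Graphs without parts are the case \<open>\<pi> = id\<close>.\<close>

definition partite :: "(colour \<Rightarrow> nat) \<Rightarrow> 'v set \<Rightarrow> ('v \<Rightarrow> nat) \<Rightarrow> ('v \<Rightarrow> 'v \<Rightarrow> colour option) \<Rightarrow> bool" where
  "partite K V \<pi> L \<longleftrightarrow> finite V \<and> (\<forall>u\<in>V. \<forall>v\<in>V. L u v = L v u) \<and>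
     (\<forall>u\<in>V. \<forall>v\<in>V. L u v \<noteq> None \<longrightarrow> \<pi> u \<noteq> \<pi> v) \<and>
     (\<forall>a S. S \<subseteq> V \<and> card S = K a \<longrightarrow> (\<exists>u\<in>S. \<exists>v\<in>S. u \<noteq> v \<and> L u v \<noteq> Some a))"

text \<open>Equality of labels includes \<open>None\<close>, so copies are induced.\<close>

definition embeds :: "('v \<Rightarrow> 'w) \<Rightarrow> 'v set \<Rightarrow> ('v \<Rightarrow> 'v \<Rightarrow> 'c) \<Rightarrow> 'w set \<Rightarrow> ('w \<Rightarrow> 'w \<Rightarrow> 'c) \<Rightarrow> bool" where
  "embeds \<phi> V L V' L' \<longleftrightarrow> inj_on \<phi> V \<and> \<phi> ` V \<subseteq> V' \<and> (\<forall>u\<in>V. \<forall>v\<in>V. L' (\<phi> u) (\<phi> v) = L u v)"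

lemma embeds_comp:
  "embeds \<phi> V L V' L' \<Longrightarrow> embeds \<psi> V' L' V'' L'' \<Longrightarrow> embeds (\<psi> \<circ> \<phi>) V L V'' L''"
  unfolding embeds_def by (auto intro: comp_inj_on inj_on_subset simp: image_subset_iff)

text \<open>A clique inside an embedded copy pulls back to one of the same size. Clique conditions
  for large graphs thus reduce to showing that a clique lies in a single copy.\<close>

lemma card_embedded_clique:
  assumes "embeds \<phi> V L V' L'" "S \<subseteq> \<phi> ` V"
    and clique: "\<And>x y. x \<in> S \<Longrightarrow> y \<in> S \<Longrightarrow> x \<noteq> y \<Longrightarrow> L' x y = Some a"
    and "partite K V \<pi> L"
  shows "card S \<noteq> K a"
proof
  assume card: "card S = K a"
  obtain T where T: "T \<subseteq> V" "S = \<phi> ` T"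
    using assms(2) by (auto simp: subset_image_iff)
  have inj: "inj_on \<phi> T"
    using assms(1) T(1) by (auto simp: embeds_def intro: inj_on_subset)
  then have "card T = K a"
    using card T(2) by (simp add: card_image)
  then obtain u v where uv: "u \<in> T" "v \<in> T" "u \<noteq> v" "L u v \<noteq> Some a"
    using assms(4) T(1) unfolding partite_def by blast
  then have "L' (\<phi> u) (\<phi> v) = Some a"
    using clique T inj by (auto simp: inj_on_eq_iff)
  with uv assms(1) T(1) show False
    by (auto simp: embeds_def subset_iff)
qed

text \<open>The constructions enlarge the vertex type by sums and products. Renaming into
  \<open>nat\<close> lets them be iterated within one type.\<close>

lemma partite_transfer_nat:
  assumes "partite K V \<pi> L"
  obtains V' :: "nat set" and \<pi>' L' e where
    "partite K V' \<pi>' L'" "embeds e V L V' L'" "\<And>v. v \<in> V \<Longrightarrow> \<pi>' (e v) = \<pi> v"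
proof -
  have fin: "finite V" using assms by (simp add: partite_def)
  obtain e :: "'a \<Rightarrow> nat" where e: "inj_on e V"
    using finite_imp_inj_to_nat_seg[OF fin] by blast
  define r where "r = inv_into V e"
  have r: "r (e v) = v" if "v \<in> V" for v
    using that e by (simp add: r_def)
  define L' where "L' = (\<lambda>x y. L (r x) (r y))"
  have emb: "embeds e V L (e ` V) L'"
    using e r by (simp add: embeds_def L'_def)
  have "partite K (e ` V) (\<pi> \<circ> r) L'"
    unfolding partite_def
  proof (intro conjI ballI impI allI)
    fix a S assume S: "S \<subseteq> e ` V \<and> card S = K a"
    then show "\<exists>u\<in>S. \<exists>v\<in>S. u \<noteq> v \<and> L' u v \<noteq> Some a"
      using card_embedded_clique[OF emb _ _ assms, of S a] by blast
  qed (use assms fin r in \<open>auto simp: partite_def L'_def\<close>)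
  then show thesis
    using emb r by (intro that[of "e ` V" "\<pi> \<circ> r" L' e]) auto
qed

text \<open>Free amalgamation of copies of a partite graph along two of its parts: a clique with at least
  three vertices has a vertex outside these two parts, and hence lies in a single copy.\<close>

lemma amalgamation:
  fixes V :: "'v set" and W :: "'w set" and F :: "('v \<Rightarrow> 'w) set"
  assumes P: "partite K V \<pi> L" and K: "\<And>a. K a \<ge> 3" and fin: "finite W" "finite F"
    and \<sigma>: "\<And>w. w \<in> W \<Longrightarrow> \<sigma> w = i \<or> \<sigma> w = j"
    and M_sym: "\<And>x y. x \<in> W \<Longrightarrow> y \<in> W \<Longrightarrow> M x y = M y x"
    and M_\<sigma>: "\<And>x y. x \<in> W \<Longrightarrow> y \<in> W \<Longrightarrow> M x y \<noteq> None \<Longrightarrow> \<sigma> x \<noteq> \<sigma> y"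
    and F: "\<And>e. e \<in> F \<Longrightarrow> embeds e {v \<in> V. \<pi> v = i \<or> \<pi> v = j} L W M"
    and F_\<sigma>: "\<And>e v. e \<in> F \<Longrightarrow> v \<in> V \<Longrightarrow> \<pi> v = i \<or> \<pi> v = j \<Longrightarrow> \<sigma> (e v) = \<pi> v"
  obtains V' :: "nat set" and \<pi>' L' \<iota> \<phi> where "partite K V' \<pi>' L'"
    "\<And>e. e \<in> F \<Longrightarrow> embeds (\<phi> e) V L V' L'"
    "\<And>e v. e \<in> F \<Longrightarrow> v \<in> V \<Longrightarrow> \<pi>' (\<phi> e v) = \<pi> v"
    "\<And>e v. e \<in> F \<Longrightarrow> v \<in> V \<Longrightarrow> \<pi> v = i \<or> \<pi> v = j \<Longrightarrow> \<phi> e v = \<iota> (e v)"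
proof -
  define U where "U = {v \<in> V. \<pi> v = i \<or> \<pi> v = j}"
  \<comment> \<open>Parts \<open>i\<close> and \<open>j\<close> of the copy \<open>e\<close> are
    glued to \<open>W\<close> along \<open>e\<close>; all other vertices are tagged with
    \<open>e\<close> and stay private to that copy.\<close>
  define \<phi> :: "('v \<Rightarrow> 'w) \<Rightarrow> 'v \<Rightarrow> 'w + ('v \<Rightarrow> 'w) \<times> 'v"
    where "\<phi> = (\<lambda>e v. if v \<in> U then Inl (e v) else Inr (e, v))"
  define V' where "V' = Inl ` W \<union> Inr ` (F \<times> V)"
  define \<pi>' :: "'w + ('v \<Rightarrow> 'w) \<times> 'v \<Rightarrow> nat"
    where "\<pi>' = (\<lambda>x. case x of Inl w \<Rightarrow> \<sigma> w | Inr (e, v) \<Rightarrow> \<pi> v)"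
  define joined where "joined = (\<lambda>x y a. \<exists>e\<in>F. \<exists>u\<in>V. \<exists>v\<in>V. x = \<phi> e u \<and> y = \<phi> e v \<and> L u v = Some a)"
  \<comment> \<open>Inside \<open>W\<close> the labels come from \<open>M\<close>; any other pair
    gets a label only from a copy containing both vertices. Such a pair determines its copy, so
    testing red first hides no blue label.\<close>
  define L' where "L' = (\<lambda>x y. if isl x \<and> isl y then M (projl x) (projl y)
      else if joined x y Red then Some Red else if joined x y Blue then Some Blue else None)"
  have L_sym: "L u v = L v u" if "u \<in> V" "v \<in> V" for u v
    using P that by (auto simp: partite_def)
  have \<phi>_inj: "inj_on (\<phi> e) V" if "e \<in> F" for e
    using F[OF that] by (auto simp: inj_on_def \<phi>_def U_def embeds_def split: if_splits)
  have \<phi>_V': "\<phi> e ` V \<subseteq> V'" if "e \<in> F" for e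
    using F[OF that] that by (auto simp: V'_def \<phi>_def U_def embeds_def)
  have \<phi>_\<pi>: "\<pi>' (\<phi> e v) = \<pi> v" if "e \<in> F" "v \<in> V" for e v
    using F_\<sigma>[OF that] by (auto simp: \<pi>'_def \<phi>_def U_def)
  have \<phi>_same: "e = e'" if "\<phi> e u = \<phi> e' u'" "\<not> isl (\<phi> e u)" for e e' u u'
    using that by (auto simp: \<phi>_def split: if_splits)
  have L'_\<phi>: "L' (\<phi> e u) (\<phi> e v) = L u v" if e: "e \<in> F" and uv: "u \<in> V" "v \<in> V" for e u v
  proof (cases "isl (\<phi> e u) \<and> isl (\<phi> e v)")
    case True
    then have "u \<in> U" "v \<in> U" by (auto simp: \<phi>_def split: if_splits)
    then show ?thesis using F[OF e] by (simp add: L'_def \<phi>_def embeds_def U_def)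
  next
    case False
    have "joined (\<phi> e u) (\<phi> e v) a \<longleftrightarrow> L u v = Some a" for a
    proof
      assume "joined (\<phi> e u) (\<phi> e v) a"
      then obtain e' u' v' where e': "e' \<in> F" "u' \<in> V" "v' \<in> V" "\<phi> e u = \<phi> e' u'" "\<phi> e v = \<phi> e' v'"
        "L u' v' = Some a"
        unfolding joined_def by blast
      then have "e' = e" using False \<phi>_same by metis
      then have "u' = u" "v' = v" using e' \<phi>_inj[OF e] uv by (auto simp: inj_on_eq_iff)
      with e' show "L u v = Some a" by simp
    qed (use that in \<open>auto simp: joined_def\<close>)
    then show ?thesis
      using False by (cases "L u v"; cases "the (L u v)") (auto simp: L'_def)
  qed
  have copy: "\<exists>e\<in>F. x \<in> \<phi> e ` V \<and> y \<in> \<phi> e ` V" if "L' x y \<noteq> None" "\<not> (isl x \<and> isl y)" for x y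
    using that by (auto simp: L'_def joined_def split: if_splits)
  have joined_sym: "joined x y a \<longleftrightarrow> joined y x a" for x y a
    unfolding joined_def using L_sym by metis
  have "partite K V' \<pi>' L'"
    unfolding partite_def
  proof (intro conjI ballI impI allI)
    show "finite V'" using fin P by (simp add: V'_def partite_def)
  next
    fix x y assume xy: "x \<in> V'" "y \<in> V'"
    show "L' x y = L' y x"
      using M_sym xy by (auto simp: L'_def joined_sym V'_def)
    assume nN: "L' x y \<noteq> None"
    show "\<pi>' x \<noteq> \<pi>' y"
    proof (cases "isl x \<and> isl y")
      case True
      then obtain w w' where "x = Inl w" "y = Inl w'" "w \<in> W" "w' \<in> W"
        using xy by (auto simp: V'_def)
      then show ?thesis using M_\<sigma> nN by (auto simp: L'_def \<pi>'_def)
    next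
      case False
      then obtain e u v where e: "e \<in> F" "u \<in> V" "v \<in> V" "x = \<phi> e u" "y = \<phi> e v"
        using copy nN by blast
      then show ?thesis using L'_\<phi> \<phi>_\<pi> nN P by (auto simp: partite_def)
    qed
  next
    fix a S assume S: "S \<subseteq> V' \<and> card S = K a"
    show "\<exists>u\<in>S. \<exists>v\<in>S. u \<noteq> v \<and> L' u v \<noteq> Some a"
    proof (rule ccontr)
      assume "\<not> ?thesis"
      then have clique: "L' x y = Some a" if "x \<in> S" "y \<in> S" "x \<noteq> y" for x y
        using that by blast
      have finS: "finite S"
        using S K[of a] by (metis card.infinite not_numeral_le_zero)
      have "\<exists>x\<in>S. \<not> isl x"
      proof (rule ccontr)
        assume "\<not> ?thesis"
        then have SW: "S \<subseteq> Inl ` W" using S unfolding V'_def by fastforce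
        \<comment> \<open>The part map is injective on a clique and takes only the values
          \<open>i\<close> and \<open>j\<close> on \<open>W\<close>, so this clique would have at
          most two vertices.\<close>
        have "inj_on \<pi>' S"
        proof (rule inj_onI, rule ccontr)
          fix x y assume xy: "x \<in> S" "y \<in> S" "\<pi>' x = \<pi>' y" "x \<noteq> y"
          then obtain w w' where "x = Inl w" "y = Inl w'" "w \<in> W" "w' \<in> W"
            using SW by blast
          then show False
            using clique[OF xy(1,2,4)] M_\<sigma>[of w w'] xy(3) by (auto simp: L'_def \<pi>'_def)
        qed
        moreover have "\<pi>' ` S \<subseteq> {i, j}"
          using SW \<sigma> by (fastforce simp: \<pi>'_def)
        ultimately have "card S \<le> card {i, j}"
          by (intro card_inj_on_le) auto
        also have "\<dots> \<le> 2" by (simp add: card_insert_if)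
        finally show False using S K[of a] by simp
      qed
      then obtain x where x: "x \<in> S" "\<not> isl x" by blast
      then obtain e v where ev: "x = Inr (e, v)" "e \<in> F" "v \<in> V"
        using S by (auto simp: V'_def)
      \<comment> \<open>The tag of \<open>x\<close> names the copy, and every vertex joined to
        \<open>x\<close> has to lie in it.\<close>
      have other: "y \<in> \<phi> e ` V \<and> x \<in> \<phi> e ` V" if y: "y \<in> S" "y \<noteq> x" for y
      proof -
        have "L' x y \<noteq> None" using clique[OF x(1) y(1)] y(2) by simp
        then obtain e' where e': "e' \<in> F" "x \<in> \<phi> e' ` V" "y \<in> \<phi> e' ` V"
          using copy[of x y] x(2) by blast
        then have "e' = e" using ev(1) by (auto simp: \<phi>_def split: if_splits)
        with e' show ?thesis by simp
      qed
      \<comment> \<open>\<open>V'\<close> also contains isolated vertices \<open>Inr (e, v)\<close>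
        with \<open>v \<in> U\<close>, outside every copy. That \<open>x\<close> itself lies in the
        copy therefore rests on its edge to a second vertex.\<close>
      have "S \<noteq> {x}" using S K[of a] by auto
      then obtain y where "y \<in> S" "y \<noteq> x" using x(1) by blast
      then have "S \<subseteq> \<phi> e ` V" using other by blast
      moreover have "embeds (\<phi> e) V L V' L'"
        using \<phi>_inj \<phi>_V' L'_\<phi> ev(2) by (simp add: embeds_def)
      ultimately have "card S \<noteq> K a"
        using card_embedded_clique[OF _ _ _ P] clique by blast
      with S show False by simp
    qed
  qed
  then obtain V'' :: "nat set" and \<pi>'' L'' \<epsilon> where *: "partite K V'' \<pi>'' L''" "embeds \<epsilon> V' L' V'' L''"
    "\<And>v. v \<in> V' \<Longrightarrow> \<pi>'' (\<epsilon> v) = \<pi>' v"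
    using partite_transfer_nat[of K V' \<pi>' L'] by metis
  show thesis
  proof (rule that[of V'' \<pi>'' L'' "\<lambda>e. \<epsilon> \<circ> \<phi> e" "\<epsilon> \<circ> Inl"])
    fix e assume e: "e \<in> F"
    have "embeds (\<phi> e) V L V' L'"
      using \<phi>_inj \<phi>_V' L'_\<phi> e by (simp add: embeds_def)
    then show "embeds (\<epsilon> \<circ> \<phi> e) V L V'' L''"
      using *(2) by (rule embeds_comp)
    fix v assume v: "v \<in> V"
    then show "\<pi>'' ((\<epsilon> \<circ> \<phi> e) v) = \<pi> v"
      using *(3) \<phi>_V'[OF e] \<phi>_\<pi>[OF e] by auto
    assume "\<pi> v = i \<or> \<pi> v = j"
    then show "(\<epsilon> \<circ> \<phi> e) v = (\<epsilon> \<circ> Inl) (e v)"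
      using v by (simp add: \<phi>_def U_def)
  qed (rule *(1))
qed

section \<open>The partite construction: one pair of parts, all pairs, graphs without parts\<close>

text \<open>Forgetting the parts prepares the graph for another round of the construction, which
  chooses its own parts.\<close>

lemma partite_id:
  assumes "partite K V \<pi> L"
  shows "partite K V id L"
proof -
  have "id u \<noteq> id v" if "u \<in> V" "v \<in> V" "L u v \<noteq> None" for u v
    using assms that unfolding partite_def id_apply by blast
  then show ?thesis
    using assms unfolding partite_def by blast
qed

text \<open>A copy of the graph is amalgamated along every part-preserving embedding of the piece
  between parts \<open>i\<close> and \<open>j\<close> into the bipartite Ramsey graph of that piece.
  A colouring yields a good embedding of the piece, and the copy glued along it extends it.\<close>

lemma partite_step:
  fixes V :: "nat set"
  assumes P: "partite K V \<pi> L" and K: "\<And>a. K a \<ge> 3" and ij: "i \<noteq> j"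
  shows "\<exists>(V' :: nat set) \<pi>' L'. partite K V' \<pi>' L' \<and>
    (\<forall>c. \<exists>\<phi>. embeds \<phi> V L V' L' \<and> (\<forall>v\<in>V. \<pi>' (\<phi> v) = \<pi> v) \<and>
       (\<exists>a :: colour. \<forall>u\<in>V. \<forall>v\<in>V. \<pi> u = i \<and> \<pi> v = j \<and> L u v = Some b \<longrightarrow> c {\<phi> u, \<phi> v} = a))"
proof -
  define X Y where "X = {v \<in> V. \<pi> v = i}" and "Y = {v \<in> V. \<pi> v = j}"
  have XY: "X \<union> Y = {v \<in> V. \<pi> v = i \<or> \<pi> v = j}" "X \<inter> Y = {}"
    using ij by (auto simp: X_def Y_def)
  have fin: "finite X" "finite Y"
    using P by (auto simp: partite_def X_def Y_def)
  have L_sym: "L u v = L v u" if "u \<in> V" "v \<in> V" for u v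
    using P that by (auto simp: partite_def)
  have L_same: "L u v = None" if "u \<in> V" "v \<in> V" "\<pi> u = \<pi> v" for u v
    using P that unfolding partite_def by blast
  from bipartite_ramsey[OF fin, of L b] obtain X' :: "nat set" and Y' :: "nat set set" and L0 where
    "finite X' \<and> finite Y' \<and> (\<forall>c. \<exists>f g. inj_on f X \<and> f ` X \<subseteq> X' \<and> inj_on g Y \<and> g ` Y \<subseteq> Y' \<and>
       (\<forall>x\<in>X. \<forall>y\<in>Y. L0 (f x) (g y) = L x y) \<and>
       (\<exists>a :: colour. \<forall>x\<in>X. \<forall>y\<in>Y. L x y = Some b \<longrightarrow> c (f x) (g y) = a))"
    by (elim exE)
  then have fin': "finite X'" "finite Y'" and
    bip: "\<And>c :: nat \<Rightarrow> nat set \<Rightarrow> colour. \<exists>f g. inj_on f X \<and> f ` X \<subseteq> X' \<and> inj_on g Y \<and> g ` Y \<subseteq> Y' \<and>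
       (\<forall>x\<in>X. \<forall>y\<in>Y. L0 (f x) (g y) = L x y) \<and>
       (\<exists>a. \<forall>x\<in>X. \<forall>y\<in>Y. L x y = Some b \<longrightarrow> c (f x) (g y) = a)"
    by simp_all
  define W :: "(nat + nat set) set" where "W = Inl ` X' \<union> Inr ` Y'"
  define M where "M = (\<lambda>x y. case x of
      Inl v \<Rightarrow> (case y of Inl _ \<Rightarrow> None | Inr w \<Rightarrow> L0 v w)
    | Inr w \<Rightarrow> (case y of Inl v \<Rightarrow> L0 v w | Inr _ \<Rightarrow> None))"
  define \<sigma> :: "nat + nat set \<Rightarrow> nat" where "\<sigma> = (\<lambda>x. if isl x then i else j)"
  \<comment> \<open>Extensional functions are taken so that \<open>F\<close> is finite.\<close>
  define F where "F = {e \<in> (X \<union> Y) \<rightarrow>\<^sub>E W. embeds e (X \<union> Y) L W M \<and> (\<forall>v\<in>X \<union> Y. \<sigma> (e v) = \<pi> v)}"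
  show ?thesis
  proof (rule amalgamation[OF P K, of W F \<sigma> i j M])
    show "finite W" using fin' by (simp add: W_def)
    then show "finite F" using fin by (simp add: F_def finite_PiE)
  next
    fix x y
    show "M x y = M y x"
      by (simp add: M_def split: sum.splits)
    show "M x y \<noteq> None \<Longrightarrow> \<sigma> x \<noteq> \<sigma> y"
      using ij by (auto simp: M_def \<sigma>_def split: sum.splits)
  next
    fix e assume "e \<in> F"
    then show "embeds e {v \<in> V. \<pi> v = i \<or> \<pi> v = j} L W M"
      "\<And>v. v \<in> V \<Longrightarrow> \<pi> v = i \<or> \<pi> v = j \<Longrightarrow> \<sigma> (e v) = \<pi> v"
      by (simp_all add: F_def XY(1))
  next
    fix V' :: "nat set" and \<pi>' L' \<iota> \<phi>
    assume am: "partite K V' \<pi>' L'"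
      "\<And>e. e \<in> F \<Longrightarrow> embeds (\<phi> e) V L V' L'"
      "\<And>e v. e \<in> F \<Longrightarrow> v \<in> V \<Longrightarrow> \<pi>' (\<phi> e v) = \<pi> v"
      "\<And>e v. e \<in> F \<Longrightarrow> v \<in> V \<Longrightarrow> \<pi> v = i \<or> \<pi> v = j \<Longrightarrow> \<phi> e v = \<iota> (e v)"
    have "\<exists>\<phi>. embeds \<phi> V L V' L' \<and> (\<forall>v\<in>V. \<pi>' (\<phi> v) = \<pi> v) \<and>
         (\<exists>a. \<forall>u\<in>V. \<forall>v\<in>V. \<pi> u = i \<and> \<pi> v = j \<and> L u v = Some b \<longrightarrow> c {\<phi> u, \<phi> v} = a)"
      for c :: "nat set \<Rightarrow> colour"
    proof -
      \<comment> \<open>The colouring is read on \<open>W\<close> through \<open>\<iota>\<close>,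
        which does not depend on the copy.\<close>
      from bip[of "\<lambda>x y. c {\<iota> (Inl x), \<iota> (Inr y)}"] obtain f g where
        "inj_on f X \<and> f ` X \<subseteq> X' \<and> inj_on g Y \<and> g ` Y \<subseteq> Y' \<and>
          (\<forall>x\<in>X. \<forall>y\<in>Y. L0 (f x) (g y) = L x y) \<and>
          (\<exists>a. \<forall>x\<in>X. \<forall>y\<in>Y. L x y = Some b \<longrightarrow> c {\<iota> (Inl (f x)), \<iota> (Inr (g y))} = a)"
        by (elim exE)
      then have fg: "inj_on f X" "f ` X \<subseteq> X'" "inj_on g Y" "g ` Y \<subseteq> Y'"
        "\<And>x y. x \<in> X \<Longrightarrow> y \<in> Y \<Longrightarrow> L0 (f x) (g y) = L x y"
        and "\<exists>a. \<forall>x\<in>X. \<forall>y\<in>Y. L x y = Some b \<longrightarrow> c {\<iota> (Inl (f x)), \<iota> (Inr (g y))} = a"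
        by simp_all
      from this(6) obtain a where
        a: "\<forall>x\<in>X. \<forall>y\<in>Y. L x y = Some b \<longrightarrow> c {\<iota> (Inl (f x)), \<iota> (Inr (g y))} = a"
        by (elim exE)
      define e where "e = restrict (\<lambda>v. if v \<in> X then Inl (f v) else Inr (g v)) (X \<union> Y)"
      have eX: "e v = Inl (f v)" if "v \<in> X" for v
        using that by (simp add: e_def)
      have eY: "e v = Inr (g v)" if "v \<in> Y" for v
        using that XY(2) by (auto simp: e_def)
      have XYV: "X \<subseteq> V" "Y \<subseteq> V" by (auto simp: X_def Y_def)
      have M_e: "M (e u) (e v) = L u v" if "u \<in> X \<union> Y" "v \<in> X \<union> Y" for u v
      proof -
        consider "u \<in> X" "v \<in> X" | "u \<in> Y" "v \<in> Y" | "u \<in> X" "v \<in> Y" | "u \<in> Y" "v \<in> X"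
          using \<open>u \<in> X \<union> Y\<close> \<open>v \<in> X \<union> Y\<close> by blast
        then show ?thesis
        proof cases
          case 1
          then show ?thesis using L_same[of u v] by (simp add: M_def eX X_def[symmetric]) (simp add: X_def)
        next
          case 2
          then show ?thesis using L_same[of u v] by (simp add: M_def eY Y_def[symmetric]) (simp add: Y_def)
        next
          case 3
          then show ?thesis by (simp add: M_def eX eY fg)
        next
          case 4
          then show ?thesis using L_sym[of u v] XYV by (simp add: M_def eX eY fg subset_iff)
        qed
      qed
      have "u = v" if "u \<in> X \<union> Y" "v \<in> X \<union> Y" "e u = e v" for u v
        using that inj_onD[OF fg(1), of u v] inj_onD[OF fg(3), of u v] by (elim UnE) (simp_all add: eX eY)
      then have "inj_on e (X \<union> Y)" by (rule inj_onI)
      moreover have "e v \<in> W" if "v \<in> X \<union> Y" for v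
        using that fg(2,4) by (auto simp: eX eY W_def)
      moreover have "\<sigma> (e v) = \<pi> v" if "v \<in> X \<union> Y" for v
        using that by (auto simp: eX eY \<sigma>_def) (auto simp: X_def Y_def)
      moreover have "e \<in> extensional (X \<union> Y)"
        by (simp add: e_def)
      ultimately have e: "e \<in> F"
        using M_e unfolding F_def embeds_def PiE_def by blast
      have "c {\<phi> e u, \<phi> e v} = a" if uv: "u \<in> V" "v \<in> V" "\<pi> u = i" "\<pi> v = j" "L u v = Some b" for u v
      proof -
        have "u \<in> X" "v \<in> Y" using uv by (auto simp: X_def Y_def)
        moreover have "\<phi> e u = \<iota> (e u)" "\<phi> e v = \<iota> (e v)"
          using am(4)[OF e] uv by auto
        ultimately show ?thesis using a uv(5) by (simp add: eX eY)
      qed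
      then show ?thesis
        using am(2,3)[OF e] by blast
    qed
    with am(1) show ?thesis by blast
  qed (auto simp: \<sigma>_def)
qed

text \<open>Pairs are treated one at a time. Uniformity for the new pair passes to the inner copy
  because the embeddings respect parts and labels; the old pairs are handled by pulling the
  colouring back.\<close>

lemma partite_iterate:
  fixes V :: "nat set"
  assumes "finite D" and P: "partite K V \<pi> L" and K: "\<And>a. K a \<ge> 3"
    and "\<forall>p\<in>D. fst p \<noteq> snd p"
  shows "\<exists>(V' :: nat set) \<pi>' L'. partite K V' \<pi>' L' \<and>
    (\<forall>c. \<exists>\<phi>. embeds \<phi> V L V' L' \<and> (\<forall>v\<in>V. \<pi>' (\<phi> v) = \<pi> v) \<and>
       (\<forall>(i, j)\<in>D. \<exists>a :: colour. \<forall>u\<in>V. \<forall>v\<in>V.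
          \<pi> u = i \<and> \<pi> v = j \<and> L u v = Some b \<longrightarrow> c {\<phi> u, \<phi> v} = a))"
  using assms(1,4)
proof (induction D rule: finite_induct)
  case empty
  have "embeds id V L V L" by (simp add: embeds_def)
  then show ?case
    using P by (intro exI[of _ V] exI[of _ \<pi>] exI[of _ L]) (auto intro!: exI[of _ id])
next
  case (insert p D)
  obtain i j where p: "p = (i, j)" by fastforce
  have "\<forall>p\<in>D. fst p \<noteq> snd p" using insert.prems by simp
  from insert.IH[OF this] obtain V1 :: "nat set" and \<pi>1 L1 where 1: "partite K V1 \<pi>1 L1 \<and>
    (\<forall>c. \<exists>\<phi>. embeds \<phi> V L V1 L1 \<and> (\<forall>v\<in>V. \<pi>1 (\<phi> v) = \<pi> v) \<and>
       (\<forall>(i, j)\<in>D. \<exists>a :: colour. \<forall>u\<in>V. \<forall>v\<in>V.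
          \<pi> u = i \<and> \<pi> v = j \<and> L u v = Some b \<longrightarrow> c {\<phi> u, \<phi> v} = a))"
    by (elim exE)
  have "i \<noteq> j" using insert.prems p by simp
  from partite_step[OF conjunct1[OF 1] K this, of b]
  obtain V2 :: "nat set" and \<pi>2 L2 where 2: "partite K V2 \<pi>2 L2 \<and>
    (\<forall>c. \<exists>\<phi>. embeds \<phi> V1 L1 V2 L2 \<and> (\<forall>v\<in>V1. \<pi>2 (\<phi> v) = \<pi>1 v) \<and>
       (\<exists>a :: colour. \<forall>u\<in>V1. \<forall>v\<in>V1. \<pi>1 u = i \<and> \<pi>1 v = j \<and> L1 u v = Some b \<longrightarrow> c {\<phi> u, \<phi> v} = a))"
    by (elim exE)
  show ?case
  proof (rule exI[of _ V2], rule exI[of _ \<pi>2], rule exI[of _ L2], intro conjI allI)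
    show "partite K V2 \<pi>2 L2" using 2 by simp
    fix c :: "nat set \<Rightarrow> colour"
    from spec[OF conjunct2[OF 2], of c] obtain \<phi>2 where "embeds \<phi>2 V1 L1 V2 L2 \<and>
      (\<forall>v\<in>V1. \<pi>2 (\<phi>2 v) = \<pi>1 v) \<and>
      (\<exists>a. \<forall>u\<in>V1. \<forall>v\<in>V1. \<pi>1 u = i \<and> \<pi>1 v = j \<and> L1 u v = Some b \<longrightarrow> c {\<phi>2 u, \<phi>2 v} = a)"
      by (elim exE)
    then have \<phi>2: "embeds \<phi>2 V1 L1 V2 L2" "\<And>v. v \<in> V1 \<Longrightarrow> \<pi>2 (\<phi>2 v) = \<pi>1 v"
      and "\<exists>a. \<forall>u\<in>V1. \<forall>v\<in>V1. \<pi>1 u = i \<and> \<pi>1 v = j \<and> L1 u v = Some b \<longrightarrow> c {\<phi>2 u, \<phi>2 v} = a"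
      by simp_all
    from this(3) obtain a where
      a: "\<forall>u\<in>V1. \<forall>v\<in>V1. \<pi>1 u = i \<and> \<pi>1 v = j \<and> L1 u v = Some b \<longrightarrow> c {\<phi>2 u, \<phi>2 v} = a"
      by (elim exE)
    \<comment> \<open>The induction hypothesis is applied to the pullback of \<open>c\<close> along
      \<open>\<phi>2\<close>.\<close>
    from spec[OF conjunct2[OF 1], of "\<lambda>e. c (\<phi>2 ` e)"] obtain \<phi>1 where "embeds \<phi>1 V L V1 L1 \<and>
      (\<forall>v\<in>V. \<pi>1 (\<phi>1 v) = \<pi> v) \<and>
      (\<forall>(i, j)\<in>D. \<exists>a. \<forall>u\<in>V. \<forall>v\<in>V. \<pi> u = i \<and> \<pi> v = j \<and> L u v = Some b \<longrightarrow>
         c (\<phi>2 ` {\<phi>1 u, \<phi>1 v}) = a)"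
      by (elim exE)
    then have \<phi>1: "embeds \<phi>1 V L V1 L1" "\<And>v. v \<in> V \<Longrightarrow> \<pi>1 (\<phi>1 v) = \<pi> v"
      "\<forall>(i, j)\<in>D. \<exists>a. \<forall>u\<in>V. \<forall>v\<in>V. \<pi> u = i \<and> \<pi> v = j \<and> L u v = Some b \<longrightarrow>
         c {\<phi>2 (\<phi>1 u), \<phi>2 (\<phi>1 v)} = a"
      by simp_all
    have in1: "\<phi>1 v \<in> V1" if "v \<in> V" for v
      using \<phi>1(1) that by (auto simp: embeds_def)
    have "c {\<phi>2 (\<phi>1 u), \<phi>2 (\<phi>1 v)} = a" if "u \<in> V" "v \<in> V" "\<pi> u = i" "\<pi> v = j" "L u v = Some b" for u v
      using that a in1 \<phi>1(1,2) by (simp add: embeds_def)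
    then have "\<forall>(i, j)\<in>insert p D. \<exists>a. \<forall>u\<in>V. \<forall>v\<in>V. \<pi> u = i \<and> \<pi> v = j \<and> L u v = Some b \<longrightarrow>
        c {(\<phi>2 \<circ> \<phi>1) u, (\<phi>2 \<circ> \<phi>1) v} = a"
      using \<phi>1(3) p by auto
    moreover have "\<forall>v\<in>V. \<pi>2 ((\<phi>2 \<circ> \<phi>1) v) = \<pi> v"
      using \<phi>1(2) \<phi>2(2) in1 by simp
    ultimately show "\<exists>\<phi>. embeds \<phi> V L V2 L2 \<and> (\<forall>v\<in>V. \<pi>2 (\<phi> v) = \<pi> v) \<and>
       (\<forall>(i, j)\<in>insert p D. \<exists>a. \<forall>u\<in>V. \<forall>v\<in>V. \<pi> u = i \<and> \<pi> v = j \<and> L u v = Some b \<longrightarrow> c {\<phi> u, \<phi> v} = a)"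
      using embeds_comp[OF \<phi>1(1) \<phi>2(1)] by blast
  qed
qed

text \<open>The construction starts from disjoint copies of the graph, one for each injection of its vertices
  into a set of \<open>N\<close> parts. Once the edges labelled \<open>b\<close> between any two parts are monochromatic, the
  colouring induces one of the pairs of parts, and Ramsey's theorem yields a suitable copy.\<close>

lemma edge_ramsey:
  fixes V :: "nat set"
  assumes P: "partite K V id L" and K: "\<And>a. K a \<ge> 3"
  shows "\<exists>(V' :: nat set) L'. partite K V' id L' \<and>
    (\<forall>c. \<exists>\<phi> a. embeds \<phi> V L V' L' \<and>
       (\<forall>u\<in>V. \<forall>v\<in>V. L u v = Some b \<longrightarrow> c {\<phi> u, \<phi> v} = (a :: colour)))"
proof -
  have finV: "finite V" using P by (simp add: partite_def)
  have L_sym: "L u v = L v u" if "u \<in> V" "v \<in> V" for u v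
    using P that by (auto simp: partite_def)
  have L_irrefl: "u \<noteq> v" if "u \<in> V" "v \<in> V" "L u v \<noteq> None" for u v
    using P that by (auto simp: partite_def)
  define m where "m = card V"
  obtain \<eta> where \<eta>: "\<eta> ` V \<subseteq> {..<m}" "inj_on \<eta> V"
    using card_le_inj[of V "{..<m}"] finV m_def by auto
  have "(UNIV :: colour set) = {Red, Blue}"
    using colour.exhaust by auto
  then have "finite (UNIV :: colour set)"
    by (metis finite.emptyI finite.insertI)
  \<comment> \<open>With \<open>N\<close> parts, every colouring of the pairs of parts is constant
    on the pairs from some \<open>m\<close> of them.\<close>
  then obtain N where N: "\<forall>col :: nat set \<Rightarrow> colour. \<exists>h z. strict_mono_on {..<m} h \<and> h ` {..<m} \<subseteq> {..<N} \<and>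
      (\<forall>T\<in>[{..<m}]\<^bsup>2\<^esup>. col (h ` T) = z)"
    using ramsey_increasing[of "UNIV :: colour set" 2 m] by auto
  define \<Psi> where "\<Psi> = {\<psi> \<in> V \<rightarrow>\<^sub>E {..<N}. inj_on \<psi> V}"
  define V0 where "V0 = \<Psi> \<times> V"
  define \<pi>0 :: "(nat \<Rightarrow> nat) \<times> nat \<Rightarrow> nat" where "\<pi>0 = (\<lambda>(\<psi>, v). \<psi> v)"
  define L0 :: "(nat \<Rightarrow> nat) \<times> nat \<Rightarrow> (nat \<Rightarrow> nat) \<times> nat \<Rightarrow> colour option"
    where "L0 = (\<lambda>(\<psi>, u) (\<psi>', v). if \<psi> = \<psi>' then L u v else None)"
  have emb0: "embeds (Pair \<psi>) V L V0 L0" if "\<psi> \<in> \<Psi>" for \<psi>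
    using that by (auto simp: embeds_def V0_def L0_def inj_on_def)
  have "partite K V0 \<pi>0 L0"
    unfolding partite_def
  proof (intro conjI ballI impI allI)
    show "finite V0"
      using finV by (simp add: V0_def \<Psi>_def finite_PiE)
  next
    fix x y assume xy: "x \<in> V0" "y \<in> V0"
    then show "L0 x y = L0 y x"
      using L_sym by (auto simp: L0_def V0_def)
    assume "L0 x y \<noteq> None"
    then show "\<pi>0 x \<noteq> \<pi>0 y"
      using xy L_irrefl by (auto simp: L0_def V0_def \<pi>0_def \<Psi>_def inj_on_eq_iff split: if_splits)
  next
    fix a S assume S: "S \<subseteq> V0 \<and> card S = K a"
    show "\<exists>u\<in>S. \<exists>v\<in>S. u \<noteq> v \<and> L0 u v \<noteq> Some a"
    proof (rule ccontr)
      assume "\<not> ?thesis"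
      then have clique: "L0 x y = Some a" if "x \<in> S" "y \<in> S" "x \<noteq> y" for x y
        using that by blast
      have "S \<noteq> {}" using S K[of a] by auto
      then obtain \<psi> v where x: "(\<psi>, v) \<in> S" by auto
      then have \<psi>: "\<psi> \<in> \<Psi>" using S by (auto simp: V0_def)
      \<comment> \<open>Labels other than \<open>None\<close> occur only inside one copy, so the
        whole clique shares \<open>\<psi>\<close>.\<close>
      have "y \<in> Pair \<psi> ` V" if "y \<in> S" for y
        using clique[OF x that] that S x by (cases "y = (\<psi>, v)") (auto simp: L0_def V0_def split: if_splits)
      then have "card S \<noteq> K a"
        using card_embedded_clique[OF emb0[OF \<psi>] _ clique P] by blast
      with S show False by simp
    qed
  qed
  then obtain V1 :: "nat set" and \<pi>1 L1 \<epsilon> where 1: "partite K V1 \<pi>1 L1" "embeds \<epsilon> V0 L0 V1 L1"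
    "\<And>v. v \<in> V0 \<Longrightarrow> \<pi>1 (\<epsilon> v) = \<pi>0 v"
    using partite_transfer_nat[of K V0 \<pi>0 L0] by metis
  \<comment> \<open>One orientation per pair of parts is enough, since \<open>c\<close> sees
    unordered edges and labels are symmetric.\<close>
  define D where "D = {(i, j). i < j \<and> j < N}"
  have "D \<subseteq> {..<N} \<times> {..<N}" by (auto simp: D_def)
  then have "finite D" by (rule finite_subset) simp
  moreover have "\<forall>p\<in>D. fst p \<noteq> snd p" by (auto simp: D_def)
  ultimately have "\<exists>(V' :: nat set) \<pi>' L'. partite K V' \<pi>' L' \<and>
    (\<forall>c. \<exists>\<phi>. embeds \<phi> V1 L1 V' L' \<and> (\<forall>v\<in>V1. \<pi>' (\<phi> v) = \<pi>1 v) \<and>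
       (\<forall>(i, j)\<in>D. \<exists>a :: colour. \<forall>u\<in>V1. \<forall>v\<in>V1.
          \<pi>1 u = i \<and> \<pi>1 v = j \<and> L1 u v = Some b \<longrightarrow> c {\<phi> u, \<phi> v} = a))"
    by (intro partite_iterate[OF _ 1(1) K])
  then obtain V' :: "nat set" and \<pi>' L' where 2: "partite K V' \<pi>' L' \<and>
    (\<forall>c. \<exists>\<phi>. embeds \<phi> V1 L1 V' L' \<and> (\<forall>v\<in>V1. \<pi>' (\<phi> v) = \<pi>1 v) \<and>
       (\<forall>(i, j)\<in>D. \<exists>a :: colour. \<forall>u\<in>V1. \<forall>v\<in>V1.
          \<pi>1 u = i \<and> \<pi>1 v = j \<and> L1 u v = Some b \<longrightarrow> c {\<phi> u, \<phi> v} = a))"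
    by (elim exE)
  have "partite K V' id L'"
    using conjunct1[OF 2] by (rule partite_id)
  moreover have "\<exists>\<phi> a. embeds \<phi> V L V' L' \<and> (\<forall>u\<in>V. \<forall>v\<in>V. L u v = Some b \<longrightarrow> c {\<phi> u, \<phi> v} = a)"
    for c :: "nat set \<Rightarrow> colour"
  proof -
    from spec[OF conjunct2[OF 2], of c] obtain \<phi> where \<phi>: "embeds \<phi> V1 L1 V' L' \<and>
      (\<forall>v\<in>V1. \<pi>' (\<phi> v) = \<pi>1 v) \<and> (\<forall>(i, j)\<in>D. \<exists>a. \<forall>u\<in>V1. \<forall>v\<in>V1.
         \<pi>1 u = i \<and> \<pi>1 v = j \<and> L1 u v = Some b \<longrightarrow> c {\<phi> u, \<phi> v} = a)"
      by (elim exE)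
    then have "\<forall>p\<in>D. \<exists>a. \<forall>u\<in>V1. \<forall>v\<in>V1. \<pi>1 u = fst p \<and> \<pi>1 v = snd p \<and> L1 u v = Some b \<longrightarrow>
        c {\<phi> u, \<phi> v} = a"
      by (simp add: case_prod_unfold)
    from bchoice[OF this] obtain A where A: "\<forall>p\<in>D. \<forall>u\<in>V1. \<forall>v\<in>V1.
        \<pi>1 u = fst p \<and> \<pi>1 v = snd p \<and> L1 u v = Some b \<longrightarrow> c {\<phi> u, \<phi> v} = A p"
      by (elim exE)
    \<comment> \<open>\<open>A\<close> becomes a colouring of two-element sets by listing the
      smaller part first, as in \<open>D\<close>.\<close>
    from spec[OF N, of "\<lambda>S. A (Min S, Max S)"] obtain h z where
      "strict_mono_on {..<m} h \<and> h ` {..<m} \<subseteq> {..<N} \<and>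
        (\<forall>T\<in>[{..<m}]\<^bsup>2\<^esup>. A (Min (h ` T), Max (h ` T)) = z)"
      by (elim exE)
    then have h: "strict_mono_on {..<m} h" "h ` {..<m} \<subseteq> {..<N}" and
      z: "\<And>T. T \<in> [{..<m}]\<^bsup>2\<^esup> \<Longrightarrow> A (Min (h ` T), Max (h ` T)) = z"
      by simp_all
    \<comment> \<open>This injection sends \<open>V\<close> into the \<open>m\<close> homogeneous
      parts; \<open>V0\<close> contains a copy for it, as for every injection.\<close>
    define \<psi> where "\<psi> = restrict (h \<circ> \<eta>) V"
    have h_inj: "inj_on h {..<m}"
      using h(1) strict_mono_on_imp_inj_on by blast
    have \<psi>_less: "\<psi> v < N" if "v \<in> V" for v
      using that h(2) \<eta>(1) by (auto simp: \<psi>_def)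
    have "inj_on (h \<circ> \<eta>) V"
      using \<eta> h_inj by (auto intro: comp_inj_on inj_on_subset)
    then have \<psi>: "\<psi> \<in> \<Psi>"
      using \<psi>_less by (auto simp: \<Psi>_def \<psi>_def inj_on_def)
    define \<theta> where "\<theta> = \<phi> \<circ> (\<epsilon> \<circ> Pair \<psi>)"
    have emb1: "embeds (\<epsilon> \<circ> Pair \<psi>) V L V1 L1"
      using embeds_comp[OF emb0[OF \<psi>] 1(2)] .
    have ordered: "c {\<theta> u, \<theta> v} = z" if uv: "u \<in> V" "v \<in> V" "L u v = Some b" "\<psi> u < \<psi> v" for u v
    proof -
      have "c {\<theta> u, \<theta> v} = A (\<psi> u, \<psi> v)"
      proof -
        have "(\<psi> u, \<psi> v) \<in> D" using uv \<psi>_less by (simp add: D_def)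
        moreover have "\<epsilon> (\<psi>, u) \<in> V1" "\<epsilon> (\<psi>, v) \<in> V1" "L1 (\<epsilon> (\<psi>, u)) (\<epsilon> (\<psi>, v)) = Some b"
          using emb1 uv by (auto simp: embeds_def)
        moreover have "\<pi>1 (\<epsilon> (\<psi>, u)) = \<psi> u" "\<pi>1 (\<epsilon> (\<psi>, v)) = \<psi> v"
          using 1(3) uv \<psi> by (auto simp: V0_def \<pi>0_def)
        ultimately show ?thesis using A by (simp add: \<theta>_def)
      qed
      also have "\<dots> = z"
      proof -
        have "h ` {\<eta> u, \<eta> v} = {\<psi> u, \<psi> v}" using uv by (simp add: \<psi>_def)
        moreover have "Min {\<psi> u, \<psi> v} = \<psi> u" "Max {\<psi> u, \<psi> v} = \<psi> v"
          using uv(4) by auto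
        moreover have "{\<eta> u, \<eta> v} \<in> [{..<m}]\<^bsup>2\<^esup>"
          using uv \<eta> by (auto simp: inj_on_eq_iff)
        ultimately show ?thesis using z by metis
      qed
      finally show ?thesis .
    qed
    have "c {\<theta> u, \<theta> v} = z" if uv: "u \<in> V" "v \<in> V" "L u v = Some b" for u v
    proof -
      have "u \<noteq> v" using L_irrefl uv by auto
      then have "\<psi> u \<noteq> \<psi> v" using \<psi> uv by (auto simp: \<Psi>_def inj_on_eq_iff)
      then consider "\<psi> u < \<psi> v" | "\<psi> v < \<psi> u" by linarith
      then show ?thesis
        using ordered[of u v] ordered[of v u] uv L_sym[of u v] by cases (auto simp: insert_commute)
    qed
    then show ?thesis
      using embeds_comp[OF emb1 conjunct1[OF \<phi>]] unfolding \<theta>_def by blast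
  qed
  ultimately show ?thesis by blast
qed

section \<open>Graphs from labellings\<close>

text \<open>The empty graph has no clique of positive size. This makes
  \<open>ramsey_number k l - 1\<close> a genuine predecessor.\<close>

lemma ramsey_number_pos:
  assumes "k > 0" "l > 0"
  shows "ramsey_number k l > 0"
proof (rule ccontr)
  assume "\<not> ?thesis"
  then have "arrows ({} :: nat set) ([{}]\<^bsup>2\<^esup>) k l"
    using arrows_ramsey_number[of k l] by simp
  then show False
    using assms by (auto simp: arrows_def nsets_empty_iff)
qed

lemma not_arrows_less_ramsey_number:
  "n < ramsey_number k l \<Longrightarrow> \<not> arrows {..<n} ([{..<n}]\<^bsup>2\<^esup>) k l"
  unfolding ramsey_number_def by (rule not_less_Least)

definition label_edges :: "'v set \<Rightarrow> ('v \<Rightarrow> 'v \<Rightarrow> colour option) \<Rightarrow> 'v set set" where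
  "label_edges V L = {{u, v} | u v. u \<in> V \<and> v \<in> V \<and> L u v \<noteq> None}"

lemma doubleton_in_label_edges:
  assumes "partite K V \<pi> L" "u \<in> V" "v \<in> V"
  shows "{u, v} \<in> label_edges V L \<longleftrightarrow> L u v \<noteq> None"
proof -
  have sym: "L u v = L v u" using assms by (simp add: partite_def)
  show ?thesis
  proof
    assume "{u, v} \<in> label_edges V L"
    then obtain u' v' where "{u, v} = {u', v'}" "L u' v' \<noteq> None"
      unfolding label_edges_def by blast
    then show "L u v \<noteq> None"
      using sym by (metis doubleton_eq_iff)
  next
    assume "L u v \<noteq> None"
    then show "{u, v} \<in> label_edges V L"
      using assms(2,3) unfolding label_edges_def by blast
  qed
qed

lemma fin_graph_label_edges:
  assumes "partite K V \<pi> L"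
  shows "fin_graph V (label_edges V L)"
proof -
  have "u \<noteq> v" if "u \<in> V" "v \<in> V" "L u v \<noteq> None" for u v
    using assms that unfolding partite_def by blast
  then show ?thesis
    using assms unfolding fin_graph_def label_edges_def partite_def by fastforce
qed

text \<open>The labelling itself, read as a colouring, is the witness.\<close>

lemma label_edges_not_arrows:
  assumes P: "partite K V \<pi> L"
  shows "\<not> arrows V (label_edges V L) (K Red) (K Blue)"
proof
  \<comment> \<open>\<open>c\<close> takes sets while \<open>L\<close> takes ordered pairs; symmetry
    of \<open>L\<close> makes this consistent. Non-edges fall under \<open>Blue\<close>, which
    \<open>colour_class\<close> ignores.\<close>
  define c where "c = (\<lambda>e. if \<exists>u\<in>V. \<exists>v\<in>V. e = {u, v} \<and> L u v = Some Red then Red else Blue)"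
  have sym: "L u v = L v u" if "u \<in> V" "v \<in> V" for u v
    using P that by (auto simp: partite_def)
  have no_clique: "\<not> clique S (colour_class (label_edges V L) c a)" if S: "S \<in> [V]\<^bsup>K a\<^esup>" for S a
  proof
    assume cl: "clique S (colour_class (label_edges V L) c a)"
    obtain u v where uv: "u \<in> S" "v \<in> S" "u \<noteq> v" "L u v \<noteq> Some a"
      using S P unfolding partite_def nsets_def by blast
    then have V: "u \<in> V" "v \<in> V" using S by (auto simp: nsets_def)
    have "{u, v} \<in> label_edges V L" "c {u, v} = a"
      using cl uv by (auto simp: clique_def colour_class_def)
    then have nN: "L u v \<noteq> None" and ca: "c {u, v} = a"
      using doubleton_in_label_edges[OF P V] by simp_all
    have "c {u, v} = Red \<longleftrightarrow> L u v = Some Red"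
      using V sym unfolding c_def by (auto simp: doubleton_eq_iff)
    with nN ca uv(4) show False
      by (cases a; cases "the (L u v)") auto
  qed
  assume "arrows V (label_edges V L) (K Red) (K Blue)"
  then show False using no_clique unfolding arrows_def by blast
qed

section \<open>The seed graph and the final argument\<close>

text \<open>No labels join different blocks, so a clique lies in one of \<open>A\<close>,
  \<open>B\<close>, \<open>C\<close>. In \<open>B\<close> and \<open>C\<close> it has at most
  \<open>l - 1\<close> vertices, fewer than \<open>l\<close> and \<open>k\<close>; in
  \<open>A\<close> the colouring \<open>\<chi>\<close> from the failed arrowing excludes it.\<close>

lemma seed_partite:
  fixes k l n :: nat
  assumes "k \<ge> l" "l \<ge> 3" and "\<not> arrows {..<n} ([{..<n}]\<^bsup>2\<^esup>) k l"
  obtains V :: "nat set" and L A B C where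
    "partite (case_colour k l) V id L" "A \<subseteq> V" "B \<subseteq> V" "C \<subseteq> V"
    "card A = n" "card B = l - 1" "card C = l - 1"
    "\<forall>u\<in>A. \<forall>v\<in>A. u \<noteq> v \<longrightarrow> L u v \<noteq> None"
    "\<forall>u\<in>B. \<forall>v\<in>B. u \<noteq> v \<longrightarrow> L u v = Some Red"
    "\<forall>u\<in>C. \<forall>v\<in>C. u \<noteq> v \<longrightarrow> L u v = Some Blue"
proof -
  let ?K = "case_colour k l"
  obtain \<chi> where \<chi>: "\<And>S a. S \<in> [{..<n}]\<^bsup>?K a\<^esup> \<Longrightarrow> \<not> clique S (colour_class ([{..<n}]\<^bsup>2\<^esup>) \<chi> a)"
  proof -
    from assms(3) obtain \<chi> where "\<forall>S\<in>[{..<n}]\<^bsup>k\<^esup>. \<not> clique S (colour_class ([{..<n}]\<^bsup>2\<^esup>) \<chi> Red)"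
      "\<forall>S\<in>[{..<n}]\<^bsup>l\<^esup>. \<not> clique S (colour_class ([{..<n}]\<^bsup>2\<^esup>) \<chi> Blue)"
      unfolding arrows_def by blast
    then show thesis
      by (intro that[of \<chi>]) (auto split: colour.splits)
  qed
  define t where "t = l - 1"
  define A B C where "A = {..<n}" and "B = {n..<n + t}" and "C = {n + t..<n + 2 * t}"
  define V where "V = A \<union> B \<union> C"
  define L where "L = (\<lambda>u v. if u = v then None
     else if u \<in> A \<and> v \<in> A then Some (\<chi> {u, v})
     else if u \<in> B \<and> v \<in> B then Some Red
     else if u \<in> C \<and> v \<in> C then Some Blue else None)"
  have disj: "A \<inter> B = {}" "A \<inter> C = {}" "B \<inter> C = {}"
    by (auto simp: A_def B_def C_def)
  have small: "card T < ?K a" if "T \<subseteq> B \<or> T \<subseteq> C" for T a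
  proof -
    have "card T \<le> t"
      using that card_mono[of B T] card_mono[of C T] by (auto simp: B_def C_def)
    then show ?thesis
      using assms(1,2) by (cases a) (auto simp: t_def)
  qed
  have "partite ?K V id L"
    unfolding partite_def
  proof (intro conjI ballI impI allI)
    show "finite V" by (simp add: V_def A_def B_def C_def)
  next
    fix u v assume "u \<in> V" "v \<in> V"
    show "L u v = L v u" by (auto simp: L_def insert_commute)
    show "id u \<noteq> id v" if "L u v \<noteq> None" using that by (auto simp: L_def)
  next
    fix a S assume S: "S \<subseteq> V \<and> card S = ?K a"
    show "\<exists>u\<in>S. \<exists>v\<in>S. u \<noteq> v \<and> L u v \<noteq> Some a"
    proof (rule ccontr)
      assume "\<not> ?thesis"
      then have clique: "L u v = Some a" if "u \<in> S" "v \<in> S" "u \<noteq> v" for u v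
        using that by blast
      have "S \<noteq> {}" using S assms(1,2) by (cases a) auto
      then obtain x where x: "x \<in> S" by blast
      have block: "S \<subseteq> D" if "x \<in> D" "D = A \<or> D = B \<or> D = C" for D
      proof
        fix y assume y: "y \<in> S"
        show "y \<in> D"
        proof (cases "y = x")
          case False
          then have "L x y \<noteq> None" using clique[OF x y] by simp
          then have "x \<in> A \<and> y \<in> A \<or> x \<in> B \<and> y \<in> B \<or> x \<in> C \<and> y \<in> C"
            unfolding L_def by (simp split: if_splits)
          then show ?thesis using that disj by blast
        qed (use that in simp)
      qed
      have "\<not> S \<subseteq> B" "\<not> S \<subseteq> C"
        using small[of S a] S by auto
      moreover have "x \<in> A \<or> x \<in> B \<or> x \<in> C"
        using x S by (auto simp: V_def)
      ultimately have "S \<subseteq> A"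
        using block by blast
      then have "S \<in> [{..<n}]\<^bsup>?K a\<^esup>"
        using S by (auto simp: A_def nsets_def intro: finite_subset)
      moreover have "clique S (colour_class ([{..<n}]\<^bsup>2\<^esup>) \<chi> a)"
        unfolding clique_def
      proof (intro ballI impI)
        fix u v assume uv: "u \<in> S" "v \<in> S" "u \<noteq> v"
        then have "u \<in> A" "v \<in> A" using \<open>S \<subseteq> A\<close> by auto
        then show "{u, v} \<in> colour_class ([{..<n}]\<^bsup>2\<^esup>) \<chi> a"
          using clique[OF uv] uv(3) by (simp add: colour_class_def L_def A_def)
      qed
      ultimately show False using \<chi> by blast
    qed
  qed
  moreover have "A \<subseteq> V" "B \<subseteq> V" "C \<subseteq> V" "card A = n" "card B = l - 1" "card C = l - 1"
    by (auto simp: V_def A_def B_def C_def t_def)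
  moreover have "\<forall>u\<in>A. \<forall>v\<in>A. u \<noteq> v \<longrightarrow> L u v \<noteq> None"
    by (simp add: L_def)
  moreover have "\<forall>u\<in>B. \<forall>v\<in>B. u \<noteq> v \<longrightarrow> L u v = Some Red"
    using disj by (auto simp: L_def)
  moreover have "\<forall>u\<in>C. \<forall>v\<in>C. u \<noteq> v \<longrightarrow> L u v = Some Blue"
    using disj by (auto simp: L_def)
  ultimately show thesis by (rule that)
qed

theorem theorem5p1:
  fixes k l :: nat
  assumes "k \<ge> l" and "l \<ge> 3"
  shows "\<exists>(V :: nat set) E. fin_graph V E \<and> \<not> arrows V E k l \<and>
           (\<forall>s. 1 \<le> s \<and> s \<le> ramsey_number k l - 1 \<longrightarrow> arrows V E s (l - 1))"
proof -
  let ?K = "case_colour k l"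
  have K: "?K a \<ge> 3" for a
    using assms by (cases a) auto
  define n where "n = ramsey_number k l - 1"
  have "n < ramsey_number k l"
    using ramsey_number_pos[of k l] assms by (simp add: n_def)
  then obtain V0 :: "nat set" and L0 A B C where seed: "partite ?K V0 id L0"
    "A \<subseteq> V0" "B \<subseteq> V0" "C \<subseteq> V0" "card A = n" "card B = l - 1" "card C = l - 1"
    "\<forall>u\<in>A. \<forall>v\<in>A. u \<noteq> v \<longrightarrow> L0 u v \<noteq> None"
    "\<forall>u\<in>B. \<forall>v\<in>B. u \<noteq> v \<longrightarrow> L0 u v = Some Red"
    "\<forall>u\<in>C. \<forall>v\<in>C. u \<noteq> v \<longrightarrow> L0 u v = Some Blue"
    by (rule seed_partite[OF assms not_arrows_less_ramsey_number])
  \<comment> \<open>Two rounds: in \<open>V1\<close> some copy of \<open>V0\<close> is uniform on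
    the red label, and in \<open>V2\<close> some copy of \<open>V1\<close> is uniform on the blue
    label.\<close>
  from edge_ramsey[OF seed(1) K, of Red] obtain V1 :: "nat set" and L1 where
    1: "partite ?K V1 id L1 \<and> (\<forall>c. \<exists>\<phi> a. embeds \<phi> V0 L0 V1 L1 \<and>
       (\<forall>u\<in>V0. \<forall>v\<in>V0. L0 u v = Some Red \<longrightarrow> c {\<phi> u, \<phi> v} = (a :: colour)))"
    by (elim exE)
  from edge_ramsey[OF conjunct1[OF 1] K, of Blue] obtain V2 :: "nat set" and L2 where
    2: "partite ?K V2 id L2 \<and> (\<forall>c. \<exists>\<phi> a. embeds \<phi> V1 L1 V2 L2 \<and>
       (\<forall>u\<in>V1. \<forall>v\<in>V1. L1 u v = Some Blue \<longrightarrow> c {\<phi> u, \<phi> v} = (a :: colour)))"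
    by (elim exE)
  define E where "E = label_edges V2 L2"
  note P2 = conjunct1[OF 2]
  have "arrows V2 E s (l - 1)" if s: "s \<le> n" for s
    unfolding arrows_def
  proof
    fix c :: "nat set \<Rightarrow> colour"
    \<comment> \<open>\<open>blue\<close>, and \<open>red\<close> below, are the colours that
      \<open>c\<close> gives to the two labels in the copy; they need not agree with their
      names.\<close>
    from spec[OF conjunct2[OF 2], of c] obtain \<phi>2 blue where \<phi>2: "embeds \<phi>2 V1 L1 V2 L2 \<and>
       (\<forall>u\<in>V1. \<forall>v\<in>V1. L1 u v = Some Blue \<longrightarrow> c {\<phi>2 u, \<phi>2 v} = blue)"
      by (elim exE)
    \<comment> \<open>The inner copy is chosen for the colouring that \<open>c\<close> induces on
      \<open>V1\<close>, so the composite is uniform on both labels.\<close>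
    from spec[OF conjunct2[OF 1], of "\<lambda>e. c (\<phi>2 ` e)"] obtain \<phi>1 red where \<phi>1: "embeds \<phi>1 V0 L0 V1 L1 \<and>
       (\<forall>u\<in>V0. \<forall>v\<in>V0. L0 u v = Some Red \<longrightarrow> c (\<phi>2 ` {\<phi>1 u, \<phi>1 v}) = red)"
      by (elim exE)
    define \<theta> where "\<theta> = \<phi>2 \<circ> \<phi>1"
    have \<theta>: "embeds \<theta> V0 L0 V2 L2"
      unfolding \<theta>_def using \<phi>1 \<phi>2 embeds_comp by blast
    have red: "c {\<theta> u, \<theta> v} = red" if "u \<in> V0" "v \<in> V0" "L0 u v = Some Red" for u v
      using \<phi>1 that by (simp add: \<theta>_def)
    have blue: "c {\<theta> u, \<theta> v} = blue" if "u \<in> V0" "v \<in> V0" "L0 u v = Some Blue" for u v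
    proof -
      have "\<phi>1 u \<in> V1" "\<phi>1 v \<in> V1" "L1 (\<phi>1 u) (\<phi>1 v) = Some Blue"
        using \<phi>1 that by (auto simp: embeds_def)
      then show ?thesis using \<phi>2 by (simp add: \<theta>_def)
    qed
    have copy: "\<exists>S\<in>[V2]\<^bsup>card T\<^esup>. clique S (colour_class E c a)"
      if T: "T \<subseteq> V0" and edge: "\<And>u v. u \<in> T \<Longrightarrow> v \<in> T \<Longrightarrow> u \<noteq> v \<Longrightarrow> L0 u v \<noteq> None \<and> c {\<theta> u, \<theta> v} = a" for T a
    proof
      have "finite T" using seed(1) T finite_subset by (auto simp: partite_def)
      moreover have "inj_on \<theta> T" "\<theta> ` T \<subseteq> V2"
        using \<theta> T by (auto simp: embeds_def intro: inj_on_subset)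
      ultimately show "\<theta> ` T \<in> [V2]\<^bsup>card T\<^esup>"
        by (simp add: nsets_def card_image)
      show "clique (\<theta> ` T) (colour_class E c a)"
        unfolding clique_def
      proof (intro ballI impI)
        fix x y assume "x \<in> \<theta> ` T" "y \<in> \<theta> ` T" "x \<noteq> y"
        then obtain u v where uv: "x = \<theta> u" "y = \<theta> v" "u \<in> T" "v \<in> T" "u \<noteq> v"
          by auto
        then have V: "\<theta> u \<in> V2" "\<theta> v \<in> V2" "L2 (\<theta> u) (\<theta> v) = L0 u v"
          using \<theta> T by (auto simp: embeds_def)
        then show "{x, y} \<in> colour_class E c a"
          using doubleton_in_label_edges[OF P2 V(1,2)] edge[OF uv(3,4,5)] uv(1,2)
          by (simp add: colour_class_def E_def)
      qed
    qed
    show "(\<exists>S\<in>[V2]\<^bsup>s\<^esup>. clique S (colour_class E c Red)) \<or>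
          (\<exists>S\<in>[V2]\<^bsup>(l - 1)\<^esup>. clique S (colour_class E c Blue))"
    proof (cases "red = Red \<and> blue = Red")
      case True
      \<comment> \<open>The image of \<open>A\<close> is a red clique on \<open>n\<close> vertices,
        of which any \<open>s\<close> will do.\<close>
      obtain T where T: "T \<subseteq> A" "card T = s"
        using s seed(5) obtain_subset_with_card_n by metis
      have "L0 u v \<noteq> None \<and> c {\<theta> u, \<theta> v} = Red" if uv: "u \<in> T" "v \<in> T" "u \<noteq> v" for u v
      proof -
        have nN: "L0 u v \<noteq> None" and V: "u \<in> V0" "v \<in> V0"
          using seed(2,8) T(1) uv by blast+
        then show ?thesis
          using red[OF V] blue[OF V] True by (cases "the (L0 u v)") auto
      qed
      then show ?thesis
        using copy[of T Red] T seed(2) by auto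
    next
      case False
      \<comment> \<open>Whichever label is coloured blue, the block carrying that label supplies the
        blue clique.\<close>
      then consider "red = Blue" | "blue = Blue"
        by (cases red; cases blue) auto
      then show ?thesis
      proof cases
        case 1
        then have "L0 u v \<noteq> None \<and> c {\<theta> u, \<theta> v} = Blue" if "u \<in> B" "v \<in> B" "u \<noteq> v" for u v
          using that seed(3) seed(9) red[of u v] by auto
        then show ?thesis using copy[OF seed(3), of Blue] seed(6) by simp
      next
        case 2
        then have "L0 u v \<noteq> None \<and> c {\<theta> u, \<theta> v} = Blue" if "u \<in> C" "v \<in> C" "u \<noteq> v" for u v
          using that seed(4) seed(10) blue[of u v] by auto
        then show ?thesis using copy[OF seed(4), of Blue] seed(7) by simp
      qed
    qed
  qed
  moreover have "\<not> arrows V2 E k l"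
    using label_edges_not_arrows[OF P2] by (simp add: E_def)
  moreover have "fin_graph V2 E"
    unfolding E_def by (rule fin_graph_label_edges[OF P2])
  ultimately show ?thesis
    unfolding n_def by blast
qed

end
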